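(* For every $x\in\mathbb{C}$ with $x\neq 0$, $$I_0(x)=\frac{1}{\pi x}\int_0^{\pi}\sin(\phi)\,\frac{\partial}{\partial x}\bigl(x\sinh(x\sin\phi)\bigr)\,d\phi .$$
   Context: $I_0(x)=\sum_{m=0}^{\infty}\frac{1}{(m!)^2}\left(\frac{x}{2}\right)^{2m}$ is the modified Bessel function of the first kind of order $0$ (equivalently $I_0(x)=J_0(ix)$). Explicitly, $\frac{\partial}{\partial x}\bigl(x\sinh(x\sin\phi)\bigr)=\sinh(x\sin\phi)+x\sin\phi\cosh(x\sin\phi)$. *)

theory Defs
  imports "HOL-Analysis.Analysis"
begin

definition bessel_I0 :: "complex \<Rightarrow> complex" where
  "bessel_I0 x = (\<Sum>m. 1 / (fact m)\<^sup>2 * (x / 2) ^ (2 * m))"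

end

theory Submission
  imports Defs
begin

text \<open>With \<open>s = sin \<phi>\<close>, the integrand is \<open>s (sinh (x s) + x s cosh (x s)) =
  (\<Sum>m. (2 m + 2) / (2 m + 1)! * x\<^sup>2\<^sup>m\<^sup>+\<^sup>1 * s\<^sup>2\<^sup>m\<^sup>+\<^sup>2)\<close>, and the convergence is uniform in \<open>\<phi>\<close>
  because \<open>\<bar>s\<bar> \<le> 1\<close>. Integrating termwise with the Wallis integrals
  gives \<open>\<pi> x\<close> times the Bessel series.\<close>

text \<open>The Wallis recursion, by induction:
  \<open>- cos \<phi> * sin \<phi> ^ (2 * m + 1)\<close> vanishes at 0 and pi, and replacing
  \<open>cos\<^sup>2\<close> by \<open>1 - sin\<^sup>2\<close> in its derivative leaves only the
  powers \<open>2 * m + 2\<close> and \<open>2 * m\<close> of the sine.\<close>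

lemma has_integral_sin_power_even:
  "((\<lambda>\<phi>::real. sin \<phi> ^ (2 * m)) has_integral (pi * fact (2 * m) / (4 ^ m * (fact m)\<^sup>2))) {0..pi}"
proof (induction m)
  case 0
  show ?case
    using has_integral_const_real[of "1::real" 0 pi] by simp
next
  case (Suc m)
  have "((\<lambda>\<phi>::real. real (2 * m + 2) * sin \<phi> ^ (2 * m + 2) - real (2 * m + 1) * sin \<phi> ^ (2 * m))
      has_integral (- cos pi * sin pi ^ (2 * m + 1) - - cos 0 * sin 0 ^ (2 * m + 1))) {0..pi}"
  proof (rule fundamental_theorem_of_calculus)
    fix \<phi> :: real
    have eq: "sin \<phi> * sin \<phi> ^ (2 * m + 1) - cos \<phi> * (real (2 * m + 1) * sin \<phi> ^ (2 * m) * cos \<phi>)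
      = real (2 * m + 2) * sin \<phi> ^ (2 * m + 2) - real (2 * m + 1) * sin \<phi> ^ (2 * m)"
      (is "?L = ?R")
    proof -
      have c: "cos \<phi> * cos \<phi> = 1 - sin \<phi> * sin \<phi>"
        using sin_cos_squared_add[of \<phi>] by (simp add: power2_eq_square)
      have "?L = sin \<phi> ^ (2 * m + 2) - real (2 * m + 1) * sin \<phi> ^ (2 * m) * (cos \<phi> * cos \<phi>)"
        by (simp add: algebra_simps)
      also have "\<dots> = ?R"
        unfolding c by (simp add: algebra_simps)
      finally show ?thesis .
    qed
    have deriv: "((\<lambda>\<phi>. - cos \<phi> * sin \<phi> ^ (k + 1)) has_real_derivative
        sin \<phi> * sin \<phi> ^ (k + 1) - cos \<phi> * (real (k + 1) * sin \<phi> ^ k * cos \<phi>)) (at \<phi> within {0..pi})" for k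
      by (rule derivative_eq_intros refl | simp add: algebra_simps)+
    show "((\<lambda>\<phi>. - cos \<phi> * sin \<phi> ^ (2 * m + 1)) has_vector_derivative ?R) (at \<phi> within {0..pi})"
      using deriv[of "2 * m"] by (simp only: eq has_real_derivative_iff_has_vector_derivative)
  qed simp
  then have "((\<lambda>\<phi>::real. real (2 * m + 2) * sin \<phi> ^ (2 * m + 2) - real (2 * m + 1) * sin \<phi> ^ (2 * m))
      has_integral 0) {0..pi}"
    by simp
  \<comment> \<open>Adding \<open>2 * m + 1\<close> times the induction hypothesis cancels the lower
    power and isolates the higher one.\<close>
  from has_integral_add[OF this has_integral_mult_right[OF Suc.IH, of "real (2 * m + 1)"]]
  have "((\<lambda>\<phi>::real. real (2 * m + 2) * sin \<phi> ^ (2 * m + 2)) has_integral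
      (real (2 * m + 1) * (pi * fact (2 * m) / (4 ^ m * (fact m)\<^sup>2)))) {0..pi}"
    by simp
  note scaled = has_integral_mult_right[OF this, of "1 / real (2 * m + 2)"]
  have cancel: "1 / real (2 * m + 2) * (real (2 * m + 2) * c) = c" for c
    by (simp add: field_simps)
  have exponent: "2 * Suc m = 2 * m + 2"
    by simp
  have "((\<lambda>\<phi>::real. sin \<phi> ^ (2 * Suc m)) has_integral
      (1 / real (2 * m + 2) * (real (2 * m + 1) * (pi * fact (2 * m) / (4 ^ m * (fact m)\<^sup>2))))) {0..pi}"
    using scaled by (simp only: cancel exponent)
  also have "1 / real (2 * m + 2) * (real (2 * m + 1) * (pi * fact (2 * m) / (4 ^ m * (fact m)\<^sup>2)))
      = pi * fact (2 * Suc m) / (4 ^ Suc m * (fact (Suc m))\<^sup>2)"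
    by (simp add: divide_simps power2_eq_square) (simp add: algebra_simps)
  finally show ?case .
qed

text \<open>The coefficients combine by 1/(2m+1)! + 1/(2m)! = (2m+2)/(2m+1)!. The general field
  allows two uses: at the complex number \<open>x * s\<close> for the integrand, and at the real
  number \<open>norm x\<close> for the majorant.\<close>

lemma sums_deriv_mult_sinh:
  fixes y :: "'a :: {banach, real_normed_field}"
  shows "(\<lambda>m. of_nat (2 * m + 2) / fact (2 * m + 1) * y ^ (2 * m + 1)) sums (sinh y + y * cosh y)"
proof -
  have s: "(\<lambda>m. y ^ (2 * m + 1) / fact (2 * m + 1)) sums sinh y"
  proof -
    \<comment> \<open>The power series of sinh runs over all exponents; its even terms are zero, so
      it may be reindexed along the odd numbers.\<close>
    have "(\<lambda>m. (\<lambda>n. if even n then 0 else y ^ n /\<^sub>R fact n) (2 * m + 1)) sums sinh y"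
      using sinh_converges[of y]
      by (subst sums_mono_reindex) (auto simp: strict_mono_def elim!: oddE)
    then show ?thesis
      by (simp add: scaleR_conv_of_real divide_inverse mult.commute del: fact_Suc)
  qed
  have c: "(\<lambda>m. y ^ (2 * m) / fact (2 * m)) sums cosh y"
  proof -
    have "(\<lambda>m. (\<lambda>n. if even n then y ^ n /\<^sub>R fact n else 0) (2 * m)) sums cosh y"
      using cosh_converges[of y]
      by (subst sums_mono_reindex) (auto simp: strict_mono_def elim!: evenE)
    then show ?thesis
      by (simp add: scaleR_conv_of_real divide_inverse mult.commute)
  qed
  have "y ^ (2 * m + 1) / fact (2 * m + 1) + y * (y ^ (2 * m) / fact (2 * m))
      = of_nat (2 * m + 2) / fact (2 * m + 1) * y ^ (2 * m + 1)" for m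
  proof -
    have "(of_nat (2 * m + 1) :: 'a) \<noteq> 0"
      by (simp only: of_nat_eq_0_iff)
    then show ?thesis
      by (simp add: divide_simps) (simp add: algebra_simps)
  qed
  then show ?thesis
    using sums_add[OF s sums_mult[OF c, of y]] by simp
qed

theorem mainTheorem4:
  fixes x :: complex
  assumes "x \<noteq> 0"
  shows "bessel_I0 x =
    1 / (complex_of_real pi * x) *
      integral {0..pi} (\<lambda>\<phi>::real. complex_of_real (sin \<phi>) *
        deriv (\<lambda>z. z * sinh (z * complex_of_real (sin \<phi>))) x)"
proof -
  define a where "a m = of_nat (2 * m + 2) / fact (2 * m + 1) * x ^ (2 * m + 1)" for m
  \<comment> \<open>The factor \<open>sin \<phi>\<close> in front of the derivative raises the
    exponent from \<open>2 * m + 1\<close> to \<open>2 * Suc m\<close>, so each term meets an even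
    Wallis integral.\<close>
  define f where "f m \<phi> = a m * complex_of_real (sin \<phi>) ^ (2 * Suc m)" for m \<phi>
  define g where "g \<phi> = complex_of_real (sin \<phi>) *
        deriv (\<lambda>z. z * sinh (z * complex_of_real (sin \<phi>))) x" for \<phi>
  have f_sums: "(\<lambda>m. f m \<phi>) sums g \<phi>" for \<phi>
  proof -
    define s where "s = complex_of_real (sin \<phi>)"
    have "((\<lambda>z. z * sinh (z * s)) has_field_derivative (sinh (x * s) + x * s * cosh (x * s))) (at x)"
      by (auto intro!: derivative_eq_intros)
    then have g: "g \<phi> = s * (sinh (x * s) + x * s * cosh (x * s))"
      by (simp add: g_def s_def DERIV_imp_deriv)
    have "f m \<phi> = s * (of_nat (2 * m + 2) / fact (2 * m + 1) * (x * s) ^ (2 * m + 1))" for m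
      by (simp add: f_def a_def s_def power_mult_distrib)
    then show ?thesis
      unfolding g using sums_mult[OF sums_deriv_mult_sinh[of "x * s"], of s] by simp
  qed
  have a_norm: "norm (a m) = of_nat (2 * m + 2) / fact (2 * m + 1) * norm x ^ (2 * m + 1)" for m
    by (simp only: a_def norm_mult norm_divide norm_power norm_of_nat norm_fact)
  have "uniform_limit {0..pi} (\<lambda>n \<phi>. \<Sum>m<n. f m \<phi>) (\<lambda>\<phi>. \<Sum>m. f m \<phi>) sequentially"
  proof (rule Weierstrass_m_test)
    \<comment> \<open>The majorant is the series of \<open>sums_deriv_mult_sinh\<close> at
      \<open>norm x\<close>, hence convergent.\<close>
    show "summable (\<lambda>m. norm (a m))"
      unfolding a_norm using sums_deriv_mult_sinh[of "norm x"] by (rule sums_summable)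
    show "norm (f m \<phi>) \<le> norm (a m)" for m \<phi>
    proof -
      have "norm (f m \<phi>) = norm (a m) * \<bar>sin \<phi>\<bar> ^ (2 * Suc m)"
        by (simp only: f_def norm_mult norm_power norm_of_real)
      also have "\<dots> \<le> norm (a m) * 1"
        by (intro mult_left_mono power_le_one) auto
      finally show ?thesis by simp
    qed
  qed
  also have "(\<lambda>\<phi>. \<Sum>m. f m \<phi>) = g"
    using f_sums by (auto simp: sums_iff)
  finally have "uniform_limit (cbox 0 pi) (\<lambda>n \<phi>. \<Sum>m<n. f m \<phi>) g sequentially"
    by simp
  \<comment> \<open>Uniform convergence of continuous partial sums gives the integrability of
    \<open>g\<close> and the exchange of limit and integral at once.\<close>
  then obtain I J where I: "\<And>n. ((\<lambda>\<phi>. \<Sum>m<n. f m \<phi>) has_integral I n) (cbox 0 pi)"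
    and J: "(g has_integral J) (cbox 0 pi)" and lim: "I \<longlonglongrightarrow> J"
    by (rule uniform_limit_integral_cbox) (auto simp: f_def intro!: continuous_intros)
  have f_int: "(f m has_integral (pi * x * (1 / (fact m)\<^sup>2 * (x / 2) ^ (2 * m)))) (cbox 0 pi)" for m
  proof -
    have "((\<lambda>\<phi>. complex_of_real (sin \<phi> ^ (2 * Suc m))) has_integral
        complex_of_real (pi * fact (2 * Suc m) / (4 ^ Suc m * (fact (Suc m))\<^sup>2))) {0..pi}"
      using has_integral_linear[OF has_integral_sin_power_even bounded_linear_of_real, of "Suc m"]
      by (simp only: o_def)
    from has_integral_mult_right[OF this, of "a m"]
    have "(f m has_integral (a m * complex_of_real (pi * fact (2 * Suc m) / (4 ^ Suc m * (fact (Suc m))\<^sup>2)))) {0..pi}"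
      by (simp only: f_def[abs_def] of_real_power)
    also have "a m * complex_of_real (pi * fact (2 * Suc m) / (4 ^ Suc m * (fact (Suc m))\<^sup>2))
      = pi * x * (1 / (fact m)\<^sup>2 * (x / 2) ^ (2 * m))"
    proof -
      \<comment> \<open>With k = m + 1, both \<open>a m\<close> and (2m+2)! contribute a factor 2k,
        and (2m+1)! cancels. The resulting 4k^2 cancels against ((m+1)!)^2 = k^2 (m!)^2 and one
        factor of 4^(m+1), leaving 4^m to form (x/2)^(2m).\<close>
      define k where "k = (of_nat (Suc m) :: complex)"
      have k: "k \<noteq> 0" by (simp only: k_def of_nat_eq_0_iff)
      have 1: "(fact (2 * Suc m) :: complex) = 2 * k * fact (2 * m + 1)"
        by (simp add: k_def algebra_simps)
      have 2: "(fact (Suc m) :: complex) = k * fact m"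
        by (simp only: k_def fact_Suc)
      have 3: "(of_nat (2 * m + 2) :: complex) = 2 * k"
        by (simp add: k_def)
      have 4: "(2 :: complex) ^ (2 * m) = 4 ^ m"
        by (simp add: power_mult)
      show ?thesis
        unfolding a_def of_real_mult of_real_divide of_real_fact of_real_power of_real_numeral 1 2 3
          power_divide 4
        using k by (simp add: divide_simps power2_eq_square del: fact_Suc)
    qed
    finally show ?thesis by simp
  qed
  \<comment> \<open>By uniqueness of integrals, the integrals of the partial sums are pi x times the
    partial sums of the Bessel series.\<close>
  have "I = (\<lambda>n. \<Sum>m<n. pi * x * (1 / (fact m)\<^sup>2 * (x / 2) ^ (2 * m)))"
    using has_integral_unique[OF I has_integral_sum[OF _ f_int]] by blast
  then have "(\<lambda>m. pi * x * (1 / (fact m)\<^sup>2 * (x / 2) ^ (2 * m))) sums J"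
    using lim by (simp only: sums_def)
  \<comment> \<open>Here \<open>x \<noteq> 0\<close> permits the division.\<close>
  from sums_mult[OF this, of "1 / (pi * x)"]
  have "(\<lambda>m. 1 / (fact m)\<^sup>2 * (x / 2) ^ (2 * m)) sums (1 / (pi * x) * J)"
    using assms by (simp add: field_simps)
  then have "bessel_I0 x = 1 / (pi * x) * J"
    by (simp add: bessel_I0_def sums_iff)
  also have "J = integral {0..pi} g"
    using J by (simp add: integral_unique)
  finally show ?thesis
    by (simp add: g_def[abs_def])
qed

end
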